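(* Let $\mu$ and $\nu$ be finite measures on a measurable space $(T,\mathscr{R})$. Let $$\mathfrak{M}=\Big\{f\in\mathscr{L}^2(\nu) : \exists\,(\varphi_n)_{n\in\mathbb{N}}\subset\mathscr{S},\ \varphi_n\to 0 \text{ in } \mathscr{L}^2(\mu),\ \varphi_n\to f \text{ in } \mathscr{L}^2(\nu)\Big\},$$ which is a closed linear subspace of $\mathscr{L}^2(\nu)$, and let $P$ be the orthogonal projection of $\mathscr{L}^2(\nu)$ onto $\mathfrak{M}$. Define the set functions $$\nu_a(E):=\int_E (I-P)1\,d\nu,\qquad \nu_s(E):=\int_E P1\,d\nu,\qquad E\in\mathscr{R},$$ where $1$ denotes the constant function $1$ and $I$ the identity operator on $\mathscr{L}^2(\nu)$ (so that $\nu=\nu_a+\nu_s$). Then both $\nu_a$ and $\nu_s$ are finite (nonnegative) measures, $\nu_a$ is absolutely continuous with respect to $\mu$, and $\nu_s$ is singular with respect to $\mu$.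
   Context: $T$ is a non-empty set and $\mathscr{R}$ is a $\sigma$-algebra of subsets of $T$. $\mathscr{S}$ denotes the real vector space of $\mathscr{R}$-simple functions, i.e. the linear span of the characteristic functions $\chi_E$, $E\in\mathscr{R}$. $\mathscr{L}^2(\mu)$ and $\mathscr{L}^2(\nu)$ are the usual real Hilbert spaces of square integrable functions, whose elements are determined only $\mu$-almost everywhere, respectively $\nu$-almost everywhere; a simple function is regarded as an element of either space. A measure $\lambda$ on $(T,\mathscr{R})$ is absolutely continuous with respect to $\mu$ if $\mu(E)=0$ implies $\lambda(E)=0$ for all $E\in\mathscr{R}$; it is singular with respect to $\mu$ if there exists $S\in\mathscr{R}$ with $\mu(S)=0$ and $\lambda(T\setminus S)=0$. *)

theory Defs
  imports "HOL-Analysis.Analysis"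
begin

text \<open>
  The measurable space \<open>(T, \<R>)\<close> is given by \<open>space\<close> and \<open>sets\<close> of a measure, and the
  \<open>\<R>\<close>-simple functions are those satisfying \<^const>\<open>simple_function\<close>.  The next lemma identifies
  these, on the space, with the linear span of the characteristic functions of measurable sets.
\<close>

lemma simple_function_iff_span_indicator:
  fixes f :: "'a \<Rightarrow> real"
  shows "simple_function M f \<longleftrightarrow>
    (\<exists>A c. finite A \<and> A \<subseteq> sets M \<and> (\<forall>t\<in>space M. f t = (\<Sum>E\<in>A. c E * indicator E t)))"
    (is "?L \<longleftrightarrow> ?R")
proof
  assume f: ?L
  define A where "A = (\<lambda>y. f -` {y} \<inter> space M) ` f ` space M"
  define c where "c E = f (SOME x. x \<in> E)" for E
  have fin: "finite A" and sub: "A \<subseteq> sets M"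
    using f unfolding A_def simple_function_def by auto
  have "f t = (\<Sum>E\<in>A. c E * indicator E t)" if t: "t \<in> space M" for t
  proof -
    define D where "D = f -` {f t} \<inter> space M"
    have D: "D \<in> A" "t \<in> D" using t by (auto simp: A_def D_def)
    have "(SOME x. x \<in> D) \<in> D" using D(2) by (rule someI)
    then have cD: "c D = f t" by (auto simp: c_def D_def)
    have "(\<Sum>E\<in>A. c E * indicator E t) = (\<Sum>E\<in>A. if E = D then f t else 0)"
    proof (rule sum.cong[OF refl])
      fix E assume "E \<in> A"
      then have "t \<in> E \<longleftrightarrow> E = D" using t by (auto simp: A_def D_def)
      then show "c E * indicator E t = (if E = D then f t else 0)"
        using cD by (simp add: indicator_def)
    qed
    then show ?thesis using fin D(1) by simp
  qed
  with fin sub show ?R by blast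
next
  assume ?R
  then obtain A c where A: "finite A" "A \<subseteq> sets M"
    and f: "\<And>t. t \<in> space M \<Longrightarrow> f t = (\<Sum>E\<in>A. c E * indicator E t)" by blast
  have "simple_function M (\<lambda>t. \<Sum>E\<in>A. c E * indicator E t)"
    using A by (intro simple_function_sum simple_function_mult simple_function_const
      simple_function_indicator) auto
  then show ?L using simple_function_cong[of M, OF f] by simp
qed

text \<open>
  Elements of the real Hilbert space \<open>\<L>\<^sup>2(N)\<close> are handled through representatives: two
  functions in \<open>L2 N\<close> denote the same element iff they agree \<open>N\<close>-almost everywhere.
\<close>

definition L2 :: "'a measure \<Rightarrow> ('a \<Rightarrow> real) set" where
  "L2 N = {f \<in> borel_measurable N. integrable N (\<lambda>t. (f t)\<^sup>2)}"

definition L2_inner :: "'a measure \<Rightarrow> ('a \<Rightarrow> real) \<Rightarrow> ('a \<Rightarrow> real) \<Rightarrow> real" where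
  "L2_inner N f g = (\<integral>t. f t * g t \<partial>N)"

definition L2_norm :: "'a measure \<Rightarrow> ('a \<Rightarrow> real) \<Rightarrow> real" where
  "L2_norm N f = sqrt (L2_inner N f f)"

text \<open>
  Membership in \<^const>\<open>L2\<close> is required because the Bochner integral of a non-integrable
  function is 0.
\<close>

definition L2_tendsto :: "'a measure \<Rightarrow> (nat \<Rightarrow> 'a \<Rightarrow> real) \<Rightarrow> ('a \<Rightarrow> real) \<Rightarrow> bool" where
  "L2_tendsto N \<phi> f \<longleftrightarrow> (\<forall>n. \<phi> n \<in> L2 N) \<and> f \<in> L2 N \<and>
    (\<lambda>n. L2_norm N (\<lambda>t. \<phi> n t - f t)) \<longlonglongrightarrow> 0"

text \<open>
  Sequential closedness, applied to constant sequences, makes \<open>V\<close> invariant under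
  almost everywhere equality, so \<open>V\<close> is a set of elements of \<open>\<L>\<^sup>2(N)\<close>.
\<close>

definition closed_L2_subspace :: "'a measure \<Rightarrow> ('a \<Rightarrow> real) set \<Rightarrow> bool" where
  "closed_L2_subspace N V \<longleftrightarrow> V \<subseteq> L2 N \<and> (\<lambda>_. 0) \<in> V \<and>
    (\<forall>f\<in>V. \<forall>g\<in>V. (\<lambda>t. f t + g t) \<in> V) \<and>
    (\<forall>c. \<forall>f\<in>V. (\<lambda>t. c * f t) \<in> V) \<and>
    (\<forall>F f. (\<forall>n. F n \<in> V) \<and> L2_tendsto N F f \<longrightarrow> f \<in> V)"

text \<open>
  \<open>P\<close> picks a representative of the orthogonal projection; on \<open>\<L>\<^sup>2(N)\<close> it is the usual operator.
\<close>

definition is_L2_projection ::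
    "'a measure \<Rightarrow> ('a \<Rightarrow> real) set \<Rightarrow> (('a \<Rightarrow> real) \<Rightarrow> 'a \<Rightarrow> real) \<Rightarrow> bool" where
  "is_L2_projection N V P \<longleftrightarrow>
    (\<forall>f\<in>L2 N. P f \<in> V \<and> (\<forall>g\<in>V. L2_inner N (\<lambda>t. f t - P f t) g = 0))"

definition limit_space :: "'a measure \<Rightarrow> 'a measure \<Rightarrow> ('a \<Rightarrow> real) set" where
  "limit_space \<mu> \<nu> = {f \<in> L2 \<nu>. \<exists>\<phi>. (\<forall>n. simple_function \<mu> (\<phi> n)) \<and>
    L2_tendsto \<mu> \<phi> (\<lambda>_. 0) \<and> L2_tendsto \<nu> \<phi> f}"

text \<open>A real set function on the measurable sets of \<open>M\<close> that is a finite nonnegative measure,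
  namely \<open>N\<close>.\<close>

definition is_finite_measure_with ::
    "'a measure \<Rightarrow> ('a set \<Rightarrow> real) \<Rightarrow> 'a measure \<Rightarrow> bool" where
  "is_finite_measure_with M m N \<longleftrightarrow>
    finite_measure N \<and> sets N = sets M \<and> (\<forall>E\<in>sets M. measure N E = m E)"

definition singular_measure :: "'a measure \<Rightarrow> 'a measure \<Rightarrow> bool" where
  "singular_measure M N \<longleftrightarrow>
    (\<exists>S\<in>sets M. emeasure M S = 0 \<and> emeasure N (space M - S) = 0)"

end

theory Submission
  imports Defs
begin

text \<open>
  Choose a \<open>\<mu>\<close>-null set \<open>S\<close> of maximal \<open>\<nu>\<close>-measure, so that \<open>\<nu>\<close> is absolutely continuous with
  respect to \<open>\<mu>\<close> off \<open>S\<close>.  Then \<open>limit_space \<mu> \<nu>\<close> consists exactly of the functions in \<open>L2 \<nu>\<close> that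
  vanish \<open>\<nu>\<close>-almost everywhere off \<open>S\<close>: an \<open>L2\<close>-limit is an almost everywhere limit along a
  subsequence, and conversely a simple approximation cut off to \<open>S\<close> is \<open>\<mu>\<close>-almost everywhere zero.
  Hence the projection is multiplication by the indicator of \<open>S\<close>, and the two set functions are the
  restrictions of \<open>\<nu>\<close> to the complement of \<open>S\<close> and to \<open>S\<close>.
\<close>

section \<open>A \<mu>-null set carrying as much \<nu>-mass as possible\<close>

text \<open>Exhaustion: null sets are closed under countable unions, so the union of a sequence
  whose \<nu>-measures approach the supremum is a null set attaining it. A null set with \<nu>-mass
  outside \<open>S\<close> could be joined to \<open>S\<close>, exceeding the supremum.\<close>

lemma maximal_null_set:
  assumes "finite_measure \<nu>" and sets: "sets \<nu> = sets \<mu>"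
  obtains S where "S \<in> null_sets \<mu>" "\<And>E. E \<in> null_sets \<mu> \<Longrightarrow> emeasure \<nu> (E - S) = 0"
proof -
  interpret \<nu>: finite_measure \<nu> by fact
  define c where "c = (SUP E\<in>null_sets \<mu>. emeasure \<nu> E)"
  have "null_sets \<mu> \<noteq> {}" by auto
  then obtain E where E: "range E \<subseteq> emeasure \<nu> ` null_sets \<mu>" "c = (SUP n::nat. E n)"
    unfolding c_def using ennreal_SUP_countable_SUP by (metis (no_types))
  then have "\<forall>n. \<exists>A\<in>null_sets \<mu>. E n = emeasure \<nu> A" by auto
  then obtain A where A: "\<And>n. A n \<in> null_sets \<mu>" "\<And>n. E n = emeasure \<nu> (A n)" by metis
  define S where "S = (\<Union>n. A n)"
  have S: "S \<in> null_sets \<mu>" unfolding S_def using A by auto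
  have "E n \<le> emeasure \<nu> S" for n
    unfolding A(2) using S sets by (intro emeasure_mono) (auto simp: S_def null_sets_def)
  then have c: "c \<le> emeasure \<nu> S" unfolding E(2) by (intro SUP_least)
  have "emeasure \<nu> (B - S) = 0" if B: "B \<in> null_sets \<mu>" for B
  proof -
    have BS: "B - S \<in> sets \<nu>" "S \<in> sets \<nu>" using B S sets by auto
    have "emeasure \<nu> S + emeasure \<nu> (B - S) = emeasure \<nu> (S \<union> (B - S))"
      using BS by (intro plus_emeasure) auto
    also have "\<dots> = emeasure \<nu> (S \<union> B)" by simp
    also have "\<dots> \<le> c" unfolding c_def using B S by (intro SUP_upper) auto
    also have "\<dots> \<le> emeasure \<nu> S + 0" using c by simp
    \<comment> \<open>Cancelling \<open>emeasure \<nu> S\<close> in \<open>ennreal\<close> requires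
      it to be finite, which is where finiteness of \<nu> enters.\<close>
    finally show ?thesis
      using \<nu>.emeasure_finite[of S] by (metis ennreal_add_left_cancel_le le_zero_eq infinity_ennreal_def)
  qed
  with S show thesis by (rule that)
qed

section \<open>Closure properties of \<open>L2\<close>\<close>

lemma L2_measurable: "f \<in> L2 N \<Longrightarrow> f \<in> borel_measurable N"
  by (simp add: L2_def)

text \<open>Squaring the bound gives a dominating integrable function
  \<open>c\<^sup>2 * (g t)\<^sup>2\<close>. This serves for scalar multiples, for cutting off to a
  set and for simple approximations.\<close>

lemma L2_bounded:
  assumes "g \<in> L2 N" "f \<in> borel_measurable N" "\<And>t. t \<in> space N \<Longrightarrow> \<bar>f t\<bar> \<le> c * \<bar>g t\<bar>"
  shows "f \<in> L2 N"
proof -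
  have "integrable N (\<lambda>t. c\<^sup>2 * (g t)\<^sup>2)" using assms(1) by (simp add: L2_def)
  then have "integrable N (\<lambda>t. (f t)\<^sup>2)"
  proof (rule Bochner_Integration.integrable_bound)
    show "(\<lambda>t. (f t)\<^sup>2) \<in> borel_measurable N"
      using assms(2) by (rule borel_measurable_power)
    show "AE t in N. norm ((f t)\<^sup>2) \<le> norm (c\<^sup>2 * (g t)\<^sup>2)"
    proof (rule AE_I2)
      fix t assume "t \<in> space N"
      from power_mono[OF assms(3)[OF this] abs_ge_zero, of 2]
      show "norm ((f t)\<^sup>2) \<le> norm (c\<^sup>2 * (g t)\<^sup>2)"
        by (simp only: power_mult_distrib power2_abs real_norm_def abs_mult abs_power2)
    qed
  qed
  then show ?thesis using assms(2) by (simp add: L2_def)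
qed

lemma L2_add:
  assumes "f \<in> L2 N" "g \<in> L2 N"
  shows "(\<lambda>t. f t + g t) \<in> L2 N"
proof -
  have "(\<lambda>t. (f t + g t)\<^sup>2) \<in> borel_measurable N" "(\<lambda>t. f t + g t) \<in> borel_measurable N"
    using assms by (auto dest!: L2_measurable)
  moreover have "integrable N (\<lambda>t. 2 * (f t)\<^sup>2 + 2 * (g t)\<^sup>2)" using assms by (auto simp: L2_def)
  moreover have "(x + y)\<^sup>2 \<le> 2 * x\<^sup>2 + 2 * y\<^sup>2" for x y :: real
    using zero_le_power2[of "x - y"] by (simp add: power2_eq_square algebra_simps)
  ultimately show ?thesis
    unfolding L2_def
    by (auto intro!: Bochner_Integration.integrable_bound[of _ "\<lambda>t. 2 * (f t)\<^sup>2 + 2 * (g t)\<^sup>2"])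
qed

lemma L2_scale: "f \<in> L2 N \<Longrightarrow> (\<lambda>t. c * f t) \<in> L2 N"
  by (rule L2_bounded[where g = f and c = "\<bar>c\<bar>"]) (auto simp: abs_mult dest: L2_measurable)

lemma L2_diff: "f \<in> L2 N \<Longrightarrow> g \<in> L2 N \<Longrightarrow> (\<lambda>t. f t - g t) \<in> L2 N"
  using L2_add[of f N "\<lambda>t. -1 * g t"] L2_scale[of g N "-1"] by simp

lemma L2_indicator_mult:
  "f \<in> L2 N \<Longrightarrow> S \<in> sets N \<Longrightarrow> (\<lambda>t. indicator S t * f t) \<in> L2 N"
  by (rule L2_bounded[where g = f and c = 1]) (auto simp: indicator_def dest: L2_measurable)

lemma L2_AE_zero:
  assumes "f \<in> borel_measurable N" "AE t in N. f t = 0"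
  shows "f \<in> L2 N"
proof -
  have "integrable N (\<lambda>t. (f t)\<^sup>2) \<longleftrightarrow> integrable N (\<lambda>t. 0::real)"
    using assms by (intro integrable_cong_AE) auto
  then show ?thesis using assms by (simp add: L2_def)
qed

section \<open>Convergence in \<open>L2\<close>\<close>

text \<open>Convergence in \<open>L2\<close> means that the squares
  \<open>(\<phi> n t - f t)\<^sup>2\<close> tend to 0 in L1, so a subsequence of these squares tends
  to 0 almost everywhere; taking square roots gives the claim.\<close>

lemma L2_tendsto_AE_subseq:
  assumes "L2_tendsto N \<phi> f"
  shows "\<exists>r. strict_mono r \<and> (AE t in N. (\<lambda>n. \<phi> (r n) t) \<longlonglongrightarrow> f t)"
proof -
  have L2: "(\<lambda>t. \<phi> n t - f t) \<in> L2 N" for n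
    using assms by (auto simp: L2_tendsto_def intro: L2_diff)
  have "(\<lambda>n. (L2_norm N (\<lambda>t. \<phi> n t - f t))\<^sup>2) \<longlonglongrightarrow> 0\<^sup>2"
    using assms by (intro tendsto_power) (simp add: L2_tendsto_def)
  then have "(\<lambda>n. \<integral>t. norm ((\<phi> n t - f t)\<^sup>2) \<partial>N) \<longlonglongrightarrow> 0"
    by (simp add: L2_norm_def L2_inner_def flip: power2_eq_square)
  then obtain r :: "nat \<Rightarrow> nat" where r: "strict_mono r"
    and *: "AE t in N. (\<lambda>n. (\<phi> (r n) t - f t)\<^sup>2) \<longlonglongrightarrow> 0"
    using tendsto_L1_AE_subseq[of N "\<lambda>n t. (\<phi> n t - f t)\<^sup>2"] L2 by (auto simp: L2_def)
  from * have "AE t in N. (\<lambda>n. \<phi> (r n) t) \<longlonglongrightarrow> f t"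
  proof (rule AE_mp, intro AE_I2 impI)
    fix t assume "(\<lambda>n. (\<phi> (r n) t - f t)\<^sup>2) \<longlonglongrightarrow> 0"
    then have "(\<lambda>n. sqrt ((\<phi> (r n) t - f t)\<^sup>2)) \<longlonglongrightarrow> sqrt 0" by (rule tendsto_real_sqrt)
    then show "(\<lambda>n. \<phi> (r n) t) \<longlonglongrightarrow> f t"
      by (auto simp: tendsto_rabs_zero_iff intro: LIM_zero_cancel)
  qed
  with r show ?thesis by blast
qed

lemma L2_tendsto_subseq:
  assumes "L2_tendsto N \<phi> f" "strict_mono r"
  shows "L2_tendsto N (\<lambda>n. \<phi> (r n)) f"
proof -
  have "(\<lambda>n. L2_norm N (\<lambda>t. \<phi> n t - f t)) \<longlonglongrightarrow> 0" using assms(1) by (simp add: L2_tendsto_def)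
  from LIMSEQ_subseq_LIMSEQ[OF this assms(2)] show ?thesis
    using assms(1) by (simp add: L2_tendsto_def comp_def)
qed

text \<open>Pointwise simple approximations of \<open>f\<close> that are dominated by a multiple of
  \<open>f\<close> converge in \<open>L2\<close> by dominated convergence.\<close>

lemma L2_simple_approximation:
  assumes f: "f \<in> L2 N"
  obtains \<phi> where "\<And>n. simple_function N (\<phi> n)" "L2_tendsto N \<phi> f"
proof -
  \<comment> \<open>The metric approximation theorem bounds the distance of
    \<open>\<phi> n t\<close> to a base point by twice that of \<open>f t\<close>. The base point 0
    turns this into a bound on absolute values.\<close>
  obtain \<phi> where simple: "\<And>n. simple_function N (\<phi> n)"
    and lim: "\<And>t. t \<in> space N \<Longrightarrow> (\<lambda>n. \<phi> n t) \<longlonglongrightarrow> f t"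
    and le: "\<And>n t. t \<in> space N \<Longrightarrow> \<bar>\<phi> n t\<bar> \<le> 2 * \<bar>f t\<bar>"
    using borel_measurable_implies_sequence_metric[OF L2_measurable[OF f], of 0]
    unfolding dist_real_def diff_0_right by metis
  have [measurable]: "\<phi> n \<in> borel_measurable N" for n
    using simple by (rule borel_measurable_simple_function)
  have [measurable]: "f \<in> borel_measurable N" using f by (rule L2_measurable)
  have L2: "\<phi> n \<in> L2 N" for n by (rule L2_bounded[where g = f and c = 2]) (auto simp: f le)
  \<comment> \<open>The factor 9 is the square of 2 + 1, from the triangle inequality and the bound
    \<open>le\<close>.\<close>
  have "(\<lambda>n. \<integral>t. (\<phi> n t - f t)\<^sup>2 \<partial>N) \<longlonglongrightarrow> (\<integral>t. 0 \<partial>N)"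
  proof (rule integral_dominated_convergence[where w = "\<lambda>t. 9 * (f t)\<^sup>2"])
    show "AE t in N. (\<lambda>n. (\<phi> n t - f t)\<^sup>2) \<longlonglongrightarrow> 0"
      using lim by (intro AE_I2) (auto intro!: tendsto_eq_intros)
    fix n
    have "(\<phi> n t - f t)\<^sup>2 \<le> 9 * (f t)\<^sup>2" if "t \<in> space N" for t
    proof -
      have "\<bar>\<phi> n t - f t\<bar> \<le> \<bar>3 * f t\<bar>" using le[OF that, of n] by linarith
      then show ?thesis unfolding abs_le_square_iff by (simp add: power_mult_distrib)
    qed
    then show "AE t in N. norm ((\<phi> n t - f t)\<^sup>2) \<le> 9 * (f t)\<^sup>2" by auto
  qed (use f in \<open>auto simp: L2_def\<close>)
  then have "(\<lambda>n. sqrt (\<integral>t. (\<phi> n t - f t)\<^sup>2 \<partial>N)) \<longlonglongrightarrow> sqrt 0"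
    by (intro tendsto_real_sqrt) simp
  then have "L2_tendsto N \<phi> f"
    using f L2 by (simp add: L2_tendsto_def L2_norm_def L2_inner_def flip: power2_eq_square)
  from simple this show thesis by (rule that)
qed

text \<open>Multiplication by an indicator is linear and does not increase the \<open>L2\<close>
  norm, hence it is continuous.\<close>

lemma L2_tendsto_indicator_mult:
  assumes "L2_tendsto N \<phi> f" "S \<in> sets N"
  shows "L2_tendsto N (\<lambda>n t. indicator S t * \<phi> n t) (\<lambda>t. indicator S t * f t)"
proof -
  have L2: "\<And>n. \<phi> n \<in> L2 N" "f \<in> L2 N" and lim: "(\<lambda>n. L2_norm N (\<lambda>t. \<phi> n t - f t)) \<longlonglongrightarrow> 0"
    using assms(1) by (auto simp: L2_tendsto_def)
  have le: "L2_norm N (\<lambda>t. indicator S t * \<phi> n t - indicator S t * f t) \<le> L2_norm N (\<lambda>t. \<phi> n t - f t)"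
    for n
  proof -
    have *: "(\<lambda>t. \<phi> n t - f t) \<in> L2 N" using L2 by (intro L2_diff)
    have "(\<integral>t. (indicator S t * (\<phi> n t - f t))\<^sup>2 \<partial>N) \<le> (\<integral>t. (\<phi> n t - f t)\<^sup>2 \<partial>N)"
      using * L2_indicator_mult[OF * assms(2)]
      by (intro integral_mono) (auto simp: L2_def indicator_def)
    then show ?thesis
      by (simp add: L2_norm_def L2_inner_def algebra_simps flip: power2_eq_square)
  qed
  have "(\<lambda>n. L2_norm N (\<lambda>t. indicator S t * \<phi> n t - indicator S t * f t)) \<longlonglongrightarrow> 0"
  proof (rule tendsto_sandwich[OF _ _ tendsto_const lim])
    show "\<forall>\<^sub>F n in sequentially. 0 \<le> L2_norm N (\<lambda>t. indicator S t * \<phi> n t - indicator S t * f t)"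
      by (simp add: L2_norm_def L2_inner_def)
  qed (simp add: le)
  then show ?thesis
    using L2 assms(2) by (auto simp: L2_tendsto_def intro: L2_indicator_mult)
qed

lemma L2_tendsto_cong_AE:
  assumes "L2_tendsto N \<phi> f" "g \<in> borel_measurable N" "AE t in N. f t = g t"
  shows "L2_tendsto N \<phi> g"
proof -
  have \<phi>: "\<And>n. \<phi> n \<in> L2 N" and f: "f \<in> L2 N" using assms(1) by (auto simp: L2_tendsto_def)
  have [measurable]: "\<And>n. \<phi> n \<in> borel_measurable N" "f \<in> borel_measurable N" "g \<in> borel_measurable N"
    using \<phi> f assms(2) by (auto dest: L2_measurable)
  have "integrable N (\<lambda>t. (g t)\<^sup>2) \<longleftrightarrow> integrable N (\<lambda>t. (f t)\<^sup>2)"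
    using assms(3) by (intro integrable_cong_AE) auto
  then have "g \<in> L2 N" using f by (simp add: L2_def)
  moreover have "L2_norm N (\<lambda>t. \<phi> n t - g t) = L2_norm N (\<lambda>t. \<phi> n t - f t)" for n
    unfolding L2_norm_def L2_inner_def
    using assms(3) by (intro arg_cong[where f = sqrt] integral_cong_AE) auto
  ultimately show ?thesis using assms(1) by (simp add: L2_tendsto_def)
qed

section \<open>The limit space as the functions supported on a set\<close>

text \<open>The support condition is imposed only almost everywhere, so that the set is invariant
  under a change of representative.\<close>

definition supported_L2 :: "'a measure \<Rightarrow> 'a set \<Rightarrow> ('a \<Rightarrow> real) set" where
  "supported_L2 N S = {f \<in> L2 N. AE t in N. t \<notin> S \<longrightarrow> f t = 0}"

lemma limit_space_eq_supported:
  assumes sets: "sets \<nu> = sets \<mu>" and S: "S \<in> null_sets \<mu>"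
    and max: "\<And>E. E \<in> null_sets \<mu> \<Longrightarrow> emeasure \<nu> (E - S) = 0"
  shows "limit_space \<mu> \<nu> = supported_L2 \<nu> S"
proof (intro equalityI subsetI)
  fix f assume "f \<in> limit_space \<mu> \<nu>"
  then obtain \<phi> where f: "f \<in> L2 \<nu>" and \<phi>: "L2_tendsto \<mu> \<phi> (\<lambda>_. 0)" "L2_tendsto \<nu> \<phi> f"
    unfolding limit_space_def by blast
  obtain r where r: "strict_mono r" "AE t in \<mu>. (\<lambda>n. \<phi> (r n) t) \<longlonglongrightarrow> 0"
    using L2_tendsto_AE_subseq[OF \<phi>(1)] by blast
  \<comment> \<open>The second subsequence is extracted from the first, so that the \<mu>-limit 0
    and the \<nu>-limit \<open>f\<close> are both reached along \<open>r (r' n)\<close>.\<close>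
  obtain r' where r': "strict_mono r'" "AE t in \<nu>. (\<lambda>n. \<phi> (r (r' n)) t) \<longlonglongrightarrow> f t"
    using L2_tendsto_AE_subseq[OF L2_tendsto_subseq[OF \<phi>(2) r(1)]] by blast
  obtain E where E: "E \<in> null_sets \<mu>" "{t \<in> space \<mu>. \<not> (\<lambda>n. \<phi> (r n) t) \<longlonglongrightarrow> 0} \<subseteq> E"
    using r(2) by (auto elim!: AE_E simp: null_sets_def)
  \<comment> \<open>The \<mu>-exceptional set \<open>E\<close> may have positive \<nu>-measure, but
    by maximality of \<open>S\<close> only inside \<open>S\<close>. Off \<open>S\<close> the two
    limits can therefore be compared \<nu>-almost everywhere.\<close>
  have "E - S \<in> null_sets \<nu>" using E S max sets by (auto simp: null_sets_def)
  then have "AE t in \<nu>. t \<notin> E - S" by (rule AE_not_in)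
  with r'(2) AE_space have "AE t in \<nu>. t \<notin> S \<longrightarrow> f t = 0"
  proof eventually_elim
    case (elim t)
    show ?case
    proof
      assume "t \<notin> S"
      with elim E(2) sets_eq_imp_space_eq[OF sets] have "(\<lambda>n. \<phi> (r n) t) \<longlonglongrightarrow> 0" by auto
      then have "(\<lambda>n. \<phi> (r (r' n)) t) \<longlonglongrightarrow> 0"
        using LIMSEQ_subseq_LIMSEQ[OF _ r'(1)] by (fastforce simp: comp_def)
      with elim show "f t = 0" using LIMSEQ_unique by blast
    qed
  qed
  with f show "f \<in> supported_L2 \<nu> S" by (simp add: supported_L2_def)
next
  fix f assume "f \<in> supported_L2 \<nu> S"
  then have f: "f \<in> L2 \<nu>" and f0: "AE t in \<nu>. t \<notin> S \<longrightarrow> f t = 0" by (auto simp: supported_L2_def)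
  have S\<nu>: "S \<in> sets \<nu>" "S \<in> sets \<mu>" using S sets by auto
  obtain \<phi> where simple: "\<And>n. simple_function \<nu> (\<phi> n)" and \<phi>: "L2_tendsto \<nu> \<phi> f"
    using L2_simple_approximation[OF f] by metis
  \<comment> \<open>The cut-off makes each \<open>\<psi> n\<close> vanish off the \<mu>-null set
    \<open>S\<close>, hence zero in \<open>L2 \<mu>\<close>, while the limit in
    \<open>L2 \<nu>\<close> is unchanged because \<open>f\<close> already vanishes off
    \<open>S\<close> almost everywhere.\<close>
  define \<psi> where "\<psi> n t = indicator S t * \<phi> n t" for n t
  have simple_\<nu>: "simple_function \<nu> (\<psi> n)" for n
    unfolding \<psi>_def using simple S\<nu> by (intro simple_function_mult simple_function_indicator)
  \<comment> \<open>Simplicity depends only on the space and the sigma-algebra, which \<mu> and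
    \<nu> share.\<close>
  then have simple_\<mu>: "simple_function \<mu> (\<psi> n)" for n
    using sets sets_eq_imp_space_eq[OF sets] simple_function_cong_algebra by blast
  have "L2_tendsto \<nu> \<psi> (\<lambda>t. indicator S t * f t)"
    unfolding \<psi>_def using \<phi> S\<nu> by (intro L2_tendsto_indicator_mult)
  moreover have "AE t in \<nu>. indicator S t * f t = f t"
    using f0 by eventually_elim (auto simp: indicator_def)
  ultimately have "L2_tendsto \<nu> \<psi> f"
    using f by (auto intro: L2_tendsto_cong_AE dest: L2_measurable)
  moreover have "L2_tendsto \<mu> \<psi> (\<lambda>_. 0)"
  proof -
    have meas: "\<psi> n \<in> borel_measurable \<mu>" for n
      using simple_\<mu> by (rule borel_measurable_simple_function)
    have zero: "AE t in \<mu>. \<psi> n t = 0" for n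
      using AE_not_in[OF S] by eventually_elim (auto simp: \<psi>_def)
    have "L2_norm \<mu> (\<lambda>t. \<psi> n t - 0) = 0" for n
      unfolding L2_norm_def L2_inner_def using zero[of n]
      by (subst integral_eq_zero_AE) auto
    moreover have "(\<lambda>_. 0) \<in> L2 \<mu>" by (simp add: L2_def)
    ultimately show ?thesis using L2_AE_zero[OF meas zero] by (simp add: L2_tendsto_def)
  qed
  ultimately show "f \<in> limit_space \<mu> \<nu>" using f simple_\<mu> unfolding limit_space_def by blast
qed

text \<open>Only closedness is more than pointwise algebra: a limit in \<open>L2\<close> is an
  almost everywhere limit along a subsequence, and off \<open>S\<close> that subsequence is
  constantly 0 almost everywhere.\<close>

lemma closed_supported_L2: "closed_L2_subspace N (supported_L2 N S)"
  unfolding closed_L2_subspace_def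
proof (intro conjI ballI allI impI)
  show "supported_L2 N S \<subseteq> L2 N" "(\<lambda>_. 0) \<in> supported_L2 N S"
    by (auto simp: supported_L2_def L2_def)
next
  fix f g assume *: "f \<in> supported_L2 N S" "g \<in> supported_L2 N S"
  then have "AE t in N. t \<notin> S \<longrightarrow> f t = 0" "AE t in N. t \<notin> S \<longrightarrow> g t = 0"
    by (auto simp: supported_L2_def)
  then have "AE t in N. t \<notin> S \<longrightarrow> f t + g t = 0" by eventually_elim auto
  with * show "(\<lambda>t. f t + g t) \<in> supported_L2 N S" by (auto simp: supported_L2_def intro: L2_add)
next
  fix c f assume *: "f \<in> supported_L2 N S"
  then have "AE t in N. t \<notin> S \<longrightarrow> c * f t = 0" by (auto simp: supported_L2_def)
  with * show "(\<lambda>t. c * f t) \<in> supported_L2 N S" by (auto simp: supported_L2_def intro: L2_scale)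
next
  fix F f assume *: "(\<forall>n. F n \<in> supported_L2 N S) \<and> L2_tendsto N F f"
  then obtain r where "AE t in N. (\<lambda>n. F (r n) t) \<longlonglongrightarrow> f t"
    using L2_tendsto_AE_subseq by blast
  \<comment> \<open>Countably many exceptional null sets merge into one that serves all
    \<open>n\<close>.\<close>
  moreover have "AE t in N. \<forall>n. t \<notin> S \<longrightarrow> F n t = 0"
    unfolding AE_all_countable using * by (simp add: supported_L2_def)
  ultimately have "AE t in N. t \<notin> S \<longrightarrow> f t = 0"
    by eventually_elim (auto simp: LIMSEQ_const_iff)
  with * show "f \<in> supported_L2 N S" by (auto simp: supported_L2_def L2_tendsto_def)
qed

section \<open>The orthogonal projection as multiplication by an indicator\<close>

text \<open>The residual \<open>f - indicator S * f\<close> vanishes on \<open>S\<close> and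
  \<open>g\<close> vanishes off \<open>S\<close>, so their product is zero almost
  everywhere.\<close>

lemma is_L2_projection_supported:
  assumes "S \<in> sets N"
  shows "is_L2_projection N (supported_L2 N S) (\<lambda>f t. indicator S t * f t)"
  unfolding is_L2_projection_def
proof (intro ballI conjI)
  fix f assume f: "f \<in> L2 N"
  then show "(\<lambda>t. indicator S t * f t) \<in> supported_L2 N S"
    using L2_indicator_mult[OF f assms] by (auto simp: supported_L2_def)
  fix g assume "g \<in> supported_L2 N S"
  then have "AE t in N. t \<notin> S \<longrightarrow> g t = 0" by (auto simp: supported_L2_def)
  then have "AE t in N. (f t - indicator S t * f t) * g t = 0"
    by eventually_elim (auto simp: indicator_def)
  then show "L2_inner N (\<lambda>t. f t - indicator S t * f t) g = 0"
    unfolding L2_inner_def by (rule integral_eq_zero_AE)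
qed

text \<open>Off \<open>S\<close> both sides vanish. On \<open>S\<close>, test orthogonality against
  the residual cut off to \<open>S\<close>: the inner product is then the integral of its square, so
  the residual is zero almost everywhere on \<open>S\<close>.\<close>

lemma is_L2_projection_supported_AE:
  assumes P: "is_L2_projection N (supported_L2 N S) P" and S: "S \<in> sets N" and f: "f \<in> L2 N"
  shows "AE t in N. P f t = indicator S t * f t"
proof -
  have Pf: "P f \<in> L2 N" "AE t in N. t \<notin> S \<longrightarrow> P f t = 0"
    and orth: "\<And>g. g \<in> supported_L2 N S \<Longrightarrow> L2_inner N (\<lambda>t. f t - P f t) g = 0"
    using P f by (auto simp: is_L2_projection_def supported_L2_def)
  define g where "g t = indicator S t * (f t - P f t)" for t
  have g: "g \<in> L2 N" unfolding g_def using f Pf S by (intro L2_indicator_mult L2_diff)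
  then have "g \<in> supported_L2 N S" by (auto simp: supported_L2_def g_def)
  then have "(\<integral>t. (f t - P f t) * g t \<partial>N) = 0" using orth by (simp add: L2_inner_def)
  also have "(\<lambda>t. (f t - P f t) * g t) = (\<lambda>t. (g t)\<^sup>2)"
    by (auto simp: g_def indicator_def power2_eq_square)
  finally have "AE t in N. (g t)\<^sup>2 = 0"
    using g integral_nonneg_eq_0_iff_AE[of N "\<lambda>t. (g t)\<^sup>2"] by (auto simp: L2_def)
  with Pf(2) show ?thesis by eventually_elim (auto simp: g_def indicator_def)
qed

section \<open>The two set functions as restrictions of \<nu>\<close>

lemma is_finite_measure_with_restriction:
  assumes "finite_measure \<nu>" "sets \<nu> = sets \<mu>" "A \<in> sets \<mu>"
    and "\<And>E. E \<in> sets \<mu> \<Longrightarrow> m E = measure \<nu> (A \<inter> E)"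
  shows "is_finite_measure_with \<mu> m (density \<nu> (indicator A))"
proof -
  interpret finite_measure \<nu> by fact
  have A: "A \<in> sets \<nu>" using assms(2,3) by simp
  have "emeasure (density \<nu> (indicator A)) (space \<nu>) = emeasure \<nu> (A \<inter> space \<nu>)"
    using A by (intro emeasure_restricted) auto
  then have "finite_measure (density \<nu> (indicator A))"
    by (intro finite_measureI) simp
  moreover have "measure (density \<nu> (indicator A)) E = m E" if "E \<in> sets \<mu>" for E
    using that A assms(2) assms(4)[OF that] by (simp add: measure_restricted)
  ultimately show ?thesis
    using assms(2) by (simp add: is_finite_measure_with_def)
qed

text \<open>A projection is determined only up to the choice of representatives. The existence
  clause keeps the final clause from being vacuous, and the agreement clause says that all choices
  define one operator on classes of functions. The set functions are real-valued, so being a measure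
  is expressed by a measure \<open>N\<^sub>a\<close> or \<open>N\<^sub>s\<close> taking the same
  values.\<close>

theorem theorem2p1:
  fixes \<mu> \<nu> :: "'a measure"
  assumes "space \<mu> \<noteq> {}"
    and "finite_measure \<mu>" and "finite_measure \<nu>"
    and "sets \<nu> = sets \<mu>"
  shows "closed_L2_subspace \<nu> (limit_space \<mu> \<nu>) \<and>
    (\<exists>P. is_L2_projection \<nu> (limit_space \<mu> \<nu>) P) \<and>
    (\<forall>P P' f f'. is_L2_projection \<nu> (limit_space \<mu> \<nu>) P \<and>
        is_L2_projection \<nu> (limit_space \<mu> \<nu>) P' \<and>
        f \<in> L2 \<nu> \<and> f' \<in> L2 \<nu> \<and> (AE t in \<nu>. f t = f' t) \<longrightarrow>
        (AE t in \<nu>. P f t = P' f' t)) \<and>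
    (\<forall>P. is_L2_projection \<nu> (limit_space \<mu> \<nu>) P \<longrightarrow>
      (let \<nu>\<^sub>a = (\<lambda>E. LINT t:E|\<nu>. 1 - P (\<lambda>_. 1) t);
           \<nu>\<^sub>s = (\<lambda>E. LINT t:E|\<nu>. P (\<lambda>_. 1) t)
       in (\<forall>E\<in>sets \<mu>. measure \<nu> E = \<nu>\<^sub>a E + \<nu>\<^sub>s E) \<and>
          (\<exists>N\<^sub>a. is_finite_measure_with \<mu> \<nu>\<^sub>a N\<^sub>a \<and> absolutely_continuous \<mu> N\<^sub>a) \<and>
          (\<exists>N\<^sub>s. is_finite_measure_with \<mu> \<nu>\<^sub>s N\<^sub>s \<and> singular_measure \<mu> N\<^sub>s)))"
proof -
  interpret \<nu>: finite_measure \<nu> by fact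
  have space: "space \<nu> = space \<mu>" using assms(4) by (rule sets_eq_imp_space_eq)
  obtain S where S: "S \<in> null_sets \<mu>" and max: "\<And>E. E \<in> null_sets \<mu> \<Longrightarrow> emeasure \<nu> (E - S) = 0"
    using maximal_null_set[OF assms(3,4)] by blast
  have S\<mu>: "S \<in> sets \<mu>" and S\<nu>: "S \<in> sets \<nu>" using S assms(4) by auto
  have V: "limit_space \<mu> \<nu> = supported_L2 \<nu> S"
    using assms(4) S max by (rule limit_space_eq_supported)
  have unique: "AE t in \<nu>. P f t = P' f' t"
    if "is_L2_projection \<nu> (supported_L2 \<nu> S) P" "is_L2_projection \<nu> (supported_L2 \<nu> S) P'"
      "f \<in> L2 \<nu>" "f' \<in> L2 \<nu>" "AE t in \<nu>. f t = f' t" for P P' f f'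
    using is_L2_projection_supported_AE[OF that(1) S\<nu> that(3)]
      is_L2_projection_supported_AE[OF that(2) S\<nu> that(4)] that(5)
    by eventually_elim simp
  have decomposition: "let \<nu>\<^sub>a = (\<lambda>E. LINT t:E|\<nu>. 1 - P (\<lambda>_. 1) t);
           \<nu>\<^sub>s = (\<lambda>E. LINT t:E|\<nu>. P (\<lambda>_. 1) t)
       in (\<forall>E\<in>sets \<mu>. measure \<nu> E = \<nu>\<^sub>a E + \<nu>\<^sub>s E) \<and>
          (\<exists>N\<^sub>a. is_finite_measure_with \<mu> \<nu>\<^sub>a N\<^sub>a \<and> absolutely_continuous \<mu> N\<^sub>a) \<and>
          (\<exists>N\<^sub>s. is_finite_measure_with \<mu> \<nu>\<^sub>s N\<^sub>s \<and> singular_measure \<mu> N\<^sub>s)"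
    if P: "is_L2_projection \<nu> (supported_L2 \<nu> S) P" for P
  proof -
    define \<nu>\<^sub>a where "\<nu>\<^sub>a E = (LINT t:E|\<nu>. 1 - P (\<lambda>_. 1) t)" for E
    define \<nu>\<^sub>s where "\<nu>\<^sub>s E = (LINT t:E|\<nu>. P (\<lambda>_. 1) t)" for E
    have one: "(\<lambda>_. 1) \<in> L2 \<nu>" by (simp add: L2_def)
    have "P (\<lambda>_. 1) \<in> L2 \<nu>"
      using P one by (auto simp: is_L2_projection_def supported_L2_def)
    then have [measurable]: "P (\<lambda>_. 1) \<in> borel_measurable \<nu>" by (rule L2_measurable)
    have P1: "AE t in \<nu>. P (\<lambda>_. 1) t = indicator S t"
      using is_L2_projection_supported_AE[OF P S\<nu> one] by simp
    have \<nu>\<^sub>s: "\<nu>\<^sub>s E = measure \<nu> (S \<inter> E)" if "E \<in> sets \<mu>" for E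
    proof -
      have [measurable]: "E \<in> sets \<nu>" "S \<in> sets \<nu>" using that S\<nu> assms(4) by auto
      have "AE t in \<nu>. indicator E t *\<^sub>R P (\<lambda>_. 1) t = indicator (S \<inter> E) t"
        using P1 by eventually_elim (auto simp: indicator_def)
      then have "\<nu>\<^sub>s E = (\<integral>t. indicator (S \<inter> E) t \<partial>\<nu>)"
        unfolding \<nu>\<^sub>s_def set_lebesgue_integral_def by (intro integral_cong_AE) measurable
      then show ?thesis by simp
    qed
    have \<nu>\<^sub>a: "\<nu>\<^sub>a E = measure \<nu> ((space \<mu> - S) \<inter> E)" if "E \<in> sets \<mu>" for E
    proof -
      have [measurable]: "E \<in> sets \<nu>" "S \<in> sets \<nu>" using that S\<nu> assms(4) by auto
      \<comment> \<open>\<open>AE_space\<close> is needed because \<open>1 - indicator S t\<close>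
        is the indicator of \<open>space \<nu> - S\<close> only for points of the space.\<close>
      have "AE t in \<nu>. indicator E t *\<^sub>R (1 - P (\<lambda>_. 1) t) = indicator ((space \<nu> - S) \<inter> E) t"
        using P1 AE_space by eventually_elim (auto simp: indicator_def)
      then have "\<nu>\<^sub>a E = (\<integral>t. indicator ((space \<nu> - S) \<inter> E) t \<partial>\<nu>)"
        unfolding \<nu>\<^sub>a_def set_lebesgue_integral_def by (intro integral_cong_AE) measurable
      \<comment> \<open>Integrating an indicator yields the measure of the set intersected with the
        space; this equation removes the extra intersection.\<close>
      moreover have "(space \<mu> - S) \<inter> E \<inter> space \<mu> = (space \<mu> - S) \<inter> E" by auto
      ultimately show ?thesis by (simp add: space)
    qed
    have "measure \<nu> E = \<nu>\<^sub>a E + \<nu>\<^sub>s E" if E: "E \<in> sets \<mu>" for E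
    proof -
      have "E = ((space \<mu> - S) \<inter> E) \<union> (S \<inter> E)" using sets.sets_into_space[OF E] by auto
      then have "measure \<nu> E = measure \<nu> (((space \<mu> - S) \<inter> E) \<union> (S \<inter> E))" by simp
      also have "\<dots> = \<nu>\<^sub>a E + \<nu>\<^sub>s E"
        unfolding \<nu>\<^sub>a[OF E] \<nu>\<^sub>s[OF E] using E S\<mu> assms(4)
        by (intro \<nu>.finite_measure_Union) auto
      finally show ?thesis .
    qed
    moreover have "is_finite_measure_with \<mu> \<nu>\<^sub>a (density \<nu> (indicator (space \<mu> - S)))"
      using assms(3,4) S\<mu> \<nu>\<^sub>a by (intro is_finite_measure_with_restriction) auto
    moreover have "absolutely_continuous \<mu> (density \<nu> (indicator (space \<mu> - S)))"
      unfolding absolutely_continuous_def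
    \<comment> \<open>On a \<mu>-null set \<open>E\<close> the restricted measure is the
      \<nu>-measure of \<open>E - S\<close>, which is 0 by the choice of \<open>S\<close>.\<close>
    proof
      fix E assume E: "E \<in> null_sets \<mu>"
      then have "(space \<mu> - S) \<inter> E = E - S" using sets.sets_into_space[of E \<mu>] by auto
      then show "E \<in> null_sets (density \<nu> (indicator (space \<mu> - S)))"
        using E S\<mu> max[OF E] assms(4) by (auto simp: null_sets_def emeasure_restricted)
    qed
    moreover have "is_finite_measure_with \<mu> \<nu>\<^sub>s (density \<nu> (indicator S))"
      using assms(3,4) S\<mu> \<nu>\<^sub>s by (intro is_finite_measure_with_restriction) auto
    moreover have "singular_measure \<mu> (density \<nu> (indicator S))"
      unfolding singular_measure_def
    \<comment> \<open>The witness is \<open>S\<close> itself: it is \<mu>-null, and the restriction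
      of \<nu> to \<open>S\<close> gives no mass to its complement.\<close>
    proof (intro bexI conjI)
      show "emeasure \<mu> S = 0" using S by auto
      have "emeasure (density \<nu> (indicator S)) (space \<mu> - S) = emeasure \<nu> (S \<inter> (space \<mu> - S))"
        using S\<mu> assms(4) by (intro emeasure_restricted) auto
      then show "emeasure (density \<nu> (indicator S)) (space \<mu> - S) = 0" by (simp add: Int_Diff)
    qed (fact S\<mu>)
    ultimately show ?thesis unfolding Let_def \<nu>\<^sub>a_def \<nu>\<^sub>s_def by blast
  qed
  show ?thesis
    unfolding V using closed_supported_L2 is_L2_projection_supported[OF S\<nu>] unique decomposition
    by blast
qed

end
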